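(* Let $\mathcal{A}$ be the set of all target contexts. The compiler ${\downarrow}$ satisfies robust hyperproperty preservation (RHP) if and only if it has no exploits, i.e. $\mathsf{Exploit}^{\mathcal{A}}(U)=\emptyset$ for all source components $U$.
   Context: There are two languages, a source language and a target language. Each has whole programs, components, contexts, and a set of behaviors ($\mathcal{B}^S$ for the source, $\mathcal{B}^T$ for the target). Linking a context $C$ with a component $U$ of the same language gives a whole program $C[U]$ (assumed always well-defined). Each whole program $P$ has a behavior $B(P)$, in $\mathcal{B}^S$ or $\mathcal{B}^T$ according to its language. A compiler ${\downarrow}$ maps source whole programs, components and contexts to target whole programs, components and contexts respectively, and is modular: $B({\downarrow}(C[U]))=B({\downarrow}C[{\downarrow}U])$ for all source contexts $C$ and source components $U$. An arbitrary relation $\mapsto$ between $\mathcal{B}^S$ and $\mathcal{B}^T$ is given. For a set $\mathcal{A}$ of target contexts and a source component $V$, $$\mathsf{Exploit}^{\mathcal{A}}(V)=\{A\in\mathcal{A}\mid \text{there is no source context } C \text{ with } B(C[V])\mapsto B(A[{\downarrow}V])\}.$$ For $\mathbb{B}\subseteq\mathcal{B}^S$, $${\downarrow}\mathbb{B}=\{b^T\in\mathcal{B}^T\mid \exists\, b^S\in\mathbb{B},\ b^S\mapsto b^T\}.$$ The compiler satisfies RHP if for every $\mathbb{B}\subseteq\mathcal{B}^S$ and every source component $U$: if $B(C^S[U])\in\mathbb{B}$ for all source contexts $C^S$, then $B(C^T[{\downarrow}U])\in{\downarrow}\mathbb{B}$ for all target contexts $C^T$. *)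

theory Defs
  imports Main
begin

text \<open>The sets of whole programs, contexts, components and behaviors of each
  language are rendered as types.\<close>

record ('p, 'c, 'u, 'b) language =
  link :: "'c \<Rightarrow> 'u \<Rightarrow> 'p"
  beh :: "'p \<Rightarrow> 'b"

record ('ps, 'cs, 'us, 'pt, 'ct, 'ut) compiler =
  compile_prog :: "'ps \<Rightarrow> 'pt"
  compile_ctx :: "'cs \<Rightarrow> 'ct"
  compile_comp :: "'us \<Rightarrow> 'ut"

definition modular ::
  "('ps, 'cs, 'us, 'bs) language \<Rightarrow> ('pt, 'ct, 'ut, 'bt) language \<Rightarrow>
   ('ps, 'cs, 'us, 'pt, 'ct, 'ut) compiler \<Rightarrow> bool" where
  "modular S T K \<longleftrightarrow>
     (\<forall>C U. beh T (compile_prog K (link S C U)) = beh T (link T (compile_ctx K C) (compile_comp K U)))"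

definition Exploit ::
  "('ps, 'cs, 'us, 'bs) language \<Rightarrow> ('pt, 'ct, 'ut, 'bt) language \<Rightarrow>
   ('ps, 'cs, 'us, 'pt, 'ct, 'ut) compiler \<Rightarrow> ('bs \<Rightarrow> 'bt \<Rightarrow> bool) \<Rightarrow>
   'ct set \<Rightarrow> 'us \<Rightarrow> 'ct set" where
  "Exploit S T K rel \<A> V =
     {A \<in> \<A>. \<not> (\<exists>C. rel (beh S (link S C V)) (beh T (link T A (compile_comp K V))))}"

definition compile_behs :: "('bs \<Rightarrow> 'bt \<Rightarrow> bool) \<Rightarrow> 'bs set \<Rightarrow> 'bt set" where
  "compile_behs rel BB = {bT. \<exists>bS \<in> BB. rel bS bT}"

definition RHP ::
  "('ps, 'cs, 'us, 'bs) language \<Rightarrow> ('pt, 'ct, 'ut, 'bt) language \<Rightarrow>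
   ('ps, 'cs, 'us, 'pt, 'ct, 'ut) compiler \<Rightarrow> ('bs \<Rightarrow> 'bt \<Rightarrow> bool) \<Rightarrow> bool" where
  "RHP S T K rel \<longleftrightarrow>
     (\<forall>BB U. (\<forall>CS. beh S (link S CS U) \<in> BB) \<longrightarrow>
             (\<forall>CT. beh T (link T CT (compile_comp K U)) \<in> compile_behs rel BB))"

end

theory Submission
  imports Defs
begin

text \<open>\<open>compile_behs rel\<close> is monotone, so for each \<open>U\<close> RHP need only
  be checked at the least admissible set, the range of source behaviors of \<open>U\<close>. There
  it says that every target context is matched by some source context, i.e. is no exploit.\<close>

theorem mainTheorem3:
  fixes S :: "('ps, 'cs, 'us, 'bs) language"
    and T :: "('pt, 'ct, 'ut, 'bt) language"
    and K :: "('ps, 'cs, 'us, 'pt, 'ct, 'ut) compiler"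
    and rel :: "'bs \<Rightarrow> 'bt \<Rightarrow> bool"
    and \<A> :: "'ct set"
  assumes "modular S T K"
    and "\<A> = UNIV"
  shows "RHP S T K rel \<longleftrightarrow> (\<forall>U. Exploit S T K rel \<A> U = {})"
proof
  assume R: "RHP S T K rel"
  show "\<forall>U. Exploit S T K rel \<A> U = {}"
  proof
    fix U
    \<comment> \<open>RHP at the smallest source hyperproperty that \<open>U\<close> robustly satisfies.\<close>
    let ?BB = "range (\<lambda>C. beh S (link S C U))"
    have "beh T (link T A (compile_comp K U)) \<in> compile_behs rel ?BB" for A
      using R[unfolded RHP_def, rule_format, of U ?BB A] by simp
    then show "Exploit S T K rel \<A> U = {}"
      by (auto simp: Exploit_def compile_behs_def)
  qed
next
  assume "\<forall>U. Exploit S T K rel \<A> U = {}"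
  then have "\<exists>C. rel (beh S (link S C U)) (beh T (link T A (compile_comp K U)))" for A U
    using assms(2) by (simp add: Exploit_def)
  then show "RHP S T K rel"
    \<comment> \<open>The behavior of \<open>U\<close> in the matching context \<open>C\<close> lies
      in any \<open>BB\<close> that \<open>U\<close> robustly satisfies, so it is the required
      witness.\<close>
    unfolding RHP_def compile_behs_def by fast
qed

end
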